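(* There exist an infinite dimensional Hilbert space $\mathcal{H}$ and an invertible bounded linear operator $T:\mathcal{H}\rightarrow\mathcal{H}$ such that $T$ is Li-Yorke chaotic but $T^{-1}$ is not Li-Yorke chaotic.
   Context: Let $(X,d)$ be a metric space and $f:X\rightarrow X$ a continuous map, with $f^n$ denoting the $n$-fold iterate. A pair $\{x,y\}\subseteq X$ is called a Li-Yorke chaotic pair (for $f$) if $$\limsup_{n\rightarrow+\infty}d(f^{n}(x),f^{n}(y))>0 \quad\text{and}\quad \liminf_{n\rightarrow+\infty}d(f^{n}(x),f^{n}(y))=0.$$ The map $f$ is called Li-Yorke chaotic if there exists an uncountable subset $\Gamma\subseteq X$ such that each pair of two distinct points in $\Gamma$ is a Li-Yorke chaotic pair. A Hilbert space is regarded as a metric space with the metric $d(x,y)=\|x-y\|$ induced by its norm. An invertible bounded linear operator is a bijective bounded linear operator whose inverse $T^{-1}$ is also a bounded linear operator. *)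

theory Defs
  imports "HOL-Analysis.Analysis" "HOL-Library.Function_Algebras"
begin

section \<open>Li-Yorke chaos on a metric space\<close>

context Metric_space
begin

text \<open>Upper and lower limits are taken in the extended reals, since the distances along two
  orbits may be unbounded.\<close>

definition li_yorke_pair :: "('a \<Rightarrow> 'a) \<Rightarrow> 'a \<Rightarrow> 'a \<Rightarrow> bool" where
  "li_yorke_pair f x y \<longleftrightarrow>
     limsup (\<lambda>n. ereal (d ((f ^^ n) x) ((f ^^ n) y))) > 0 \<and>
     liminf (\<lambda>n. ereal (d ((f ^^ n) x) ((f ^^ n) y))) = 0"

definition li_yorke_chaotic :: "('a \<Rightarrow> 'a) \<Rightarrow> bool" where
  "li_yorke_chaotic f \<longleftrightarrow>
     (\<exists>\<Gamma>\<subseteq>M. uncountable \<Gamma> \<and> (\<forall>x\<in>\<Gamma>. \<forall>y\<in>\<Gamma>. x \<noteq> y \<longrightarrow> li_yorke_pair f x y))"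

end

section \<open>Complex Hilbert spaces with an explicit carrier\<close>

text \<open>The space is a linear subspace \<open>H\<close> of an ambient complex vector space, with an inner
  product (linear in the first argument) that need only make sense on \<open>H\<close> and is unrelated to
  any structure the ambient type may have. An existential claim over Hilbert spaces becomes one
  over the operations and \<open>H\<close> for a fixed ambient type; \<open>nat \<Rightarrow> complex\<close> contains a copy of every
  complex vector space of dimension at most the continuum.\<close>

locale complex_inner_product_space = vector_space scale
  for scale :: "complex \<Rightarrow> 'v::ab_group_add \<Rightarrow> 'v" +
  fixes H :: "'v set" and cinner :: "'v \<Rightarrow> 'v \<Rightarrow> complex"
  assumes subspace_carrier: "subspace H"
    and cinner_add_left:
      "\<lbrakk>x \<in> H; y \<in> H; z \<in> H\<rbrakk> \<Longrightarrow> cinner (x + y) z = cinner x z + cinner y z"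
    and cinner_scale_left:
      "\<lbrakk>x \<in> H; y \<in> H\<rbrakk> \<Longrightarrow> cinner (scale a x) y = a * cinner x y"
    and cinner_commute: "\<lbrakk>x \<in> H; y \<in> H\<rbrakk> \<Longrightarrow> cinner y x = cnj (cinner x y)"
    and cinner_pos: "\<lbrakk>x \<in> H; x \<noteq> 0\<rbrakk> \<Longrightarrow> Re (cinner x x) > 0"
begin

definition hnorm :: "'v \<Rightarrow> real" where
  "hnorm x = sqrt (Re (cinner x x))"

text \<open>The value off \<open>H\<close> is immaterial; it is fixed because the locale \<^locale>\<open>Metric_space\<close> asks
  for a nonnegative symmetric function on the whole type.\<close>

definition hdist :: "'v \<Rightarrow> 'v \<Rightarrow> real" where
  "hdist x y = (if x \<in> H \<and> y \<in> H then hnorm (x - y) else 0)"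

definition infinite_dimensional :: bool where
  "infinite_dimensional \<longleftrightarrow> (\<nexists>B. finite B \<and> span B = H)"

definition bounded_operator :: "('v \<Rightarrow> 'v) \<Rightarrow> bool" where
  "bounded_operator T \<longleftrightarrow>
     T \<in> H \<rightarrow> H \<and>
     (\<forall>x\<in>H. \<forall>y\<in>H. T (x + y) = T x + T y) \<and>
     (\<forall>a. \<forall>x\<in>H. T (scale a x) = scale a (T x)) \<and>
     (\<exists>K. \<forall>x\<in>H. hnorm (T x) \<le> K * hnorm x)"

definition invertible_operator :: "('v \<Rightarrow> 'v) \<Rightarrow> bool" where
  "invertible_operator T \<longleftrightarrow>
     bounded_operator T \<and> bij_betw T H H \<and> bounded_operator (inv_into H T)"

lemma carrier_closed:
  shows "0 \<in> H" "\<lbrakk>x \<in> H; y \<in> H\<rbrakk> \<Longrightarrow> x + y \<in> H" "x \<in> H \<Longrightarrow> scale a x \<in> H"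
    "\<lbrakk>x \<in> H; y \<in> H\<rbrakk> \<Longrightarrow> x - y \<in> H"
  using subspace_carrier
  by (auto simp: subspace_0 subspace_add subspace_scale subspace_diff)

lemma cinner_zero: "y \<in> H \<Longrightarrow> cinner 0 y = 0"
  using cinner_scale_left[of 0 y 0] carrier_closed(1) by simp

lemma cinner_nonneg: "x \<in> H \<Longrightarrow> 0 \<le> Re (cinner x x)"
  using cinner_pos[of x] cinner_zero[of x] by (cases "x = 0") auto

lemma hnorm_square: "x \<in> H \<Longrightarrow> (hnorm x)\<^sup>2 = Re (cinner x x)"
  by (simp add: hnorm_def cinner_nonneg)

lemma hnorm_nonneg: "x \<in> H \<Longrightarrow> 0 \<le> hnorm x"
  by (simp add: hnorm_def cinner_nonneg)

lemma hnorm_eq_0: "x \<in> H \<Longrightarrow> hnorm x = 0 \<longleftrightarrow> x = 0"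
  using cinner_pos[of x] cinner_zero[of x] by (cases "x = 0") (auto simp: hnorm_def)

lemma cinner_add_scale_self:
  assumes "x \<in> H" "y \<in> H"
  shows "Re (cinner (x + scale (of_real t) y) (x + scale (of_real t) y)) =
    Re (cinner x x) + 2 * t * Re (cinner x y) + t\<^sup>2 * Re (cinner y y)"
proof -
  let ?s = "scale (of_real t) y"
  have s: "?s \<in> H" using assms carrier_closed by blast
  have xs: "x + ?s \<in> H" using assms s carrier_closed by blast
  have 1: "cinner ?s w = of_real t * cinner y w" if "w \<in> H" for w
    using assms that by (simp add: cinner_scale_left)
  have 2: "cinner w ?s = of_real t * cinner w y" if "w \<in> H" for w
    using 1[OF that] cinner_commute[OF s that] cinner_commute[OF assms(2) that] by simp
  have 3: "cinner x (x + ?s) = cinner x x + cinner x ?s"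
    using cinner_commute[OF xs assms(1)] cinner_add_left[OF assms(1) s assms(1)]
      cinner_commute[OF s assms(1)] cinner_commute[OF assms(1) assms(1)] by simp
  have 4: "cinner y (x + ?s) = cinner y x + cinner y ?s"
    using cinner_commute[OF xs assms(2)] cinner_add_left[OF assms(1) s assms(2)]
      cinner_commute[OF s assms(2)] cinner_commute[OF assms(1) assms(2)] by simp
  have "cinner (x + ?s) (x + ?s) =
      cinner x x + of_real t * cinner x y + of_real t * (cinner y x + of_real t * cinner y y)"
    using assms s xs by (simp add: cinner_add_left 1 2 3 4)
  moreover have "Re (cinner y x) = Re (cinner x y)"
    using cinner_commute[OF assms] by simp
  ultimately show ?thesis by (simp add: algebra_simps power2_eq_square)
qed

lemma Re_cinner_le:
  assumes "x \<in> H" "y \<in> H"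
  shows "Re (cinner x y) \<le> hnorm x * hnorm y"
proof (cases "y = 0")
  case True
  then show ?thesis
    using cinner_commute[OF assms(2,1)] cinner_zero[OF assms(1)] cinner_zero[OF assms(2)]
    by (simp add: hnorm_def)
next
  case False
  define a b c where "a = Re (cinner x x)" and "b = Re (cinner x y)" and "c = Re (cinner y y)"
  have c: "c > 0" using False assms cinner_pos by (simp add: c_def)
  have "0 \<le> a + 2 * (- b / c) * b + (- b / c)\<^sup>2 * c"
    using cinner_add_scale_self[OF assms, of "- b / c"] cinner_nonneg
      carrier_closed assms unfolding a_def b_def c_def by metis
  also have "\<dots> = (a * c - b\<^sup>2) / c"
    using c by (simp add: field_simps power2_eq_square)
  finally have "b\<^sup>2 \<le> a * c" using c by (simp add: zero_le_divide_iff)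
  then have "b \<le> sqrt (a * c)" by (rule real_le_rsqrt)
  then show ?thesis by (simp add: a_def b_def c_def hnorm_def real_sqrt_mult)
qed

lemma hnorm_add_le:
  assumes "x \<in> H" "y \<in> H"
  shows "hnorm (x + y) \<le> hnorm x + hnorm y"
proof (rule power2_le_imp_le)
  have "(hnorm (x + y))\<^sup>2 = (hnorm x)\<^sup>2 + 2 * Re (cinner x y) + (hnorm y)\<^sup>2"
    using cinner_add_scale_self[OF assms, of 1] assms carrier_closed
    by (simp add: hnorm_square)
  then show "(hnorm (x + y))\<^sup>2 \<le> (hnorm x + hnorm y)\<^sup>2"
    using Re_cinner_le[OF assms] by (simp add: power2_sum)
qed (use assms hnorm_nonneg in simp)

lemma hnorm_minus_commute:
  assumes "x \<in> H" "y \<in> H"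
  shows "hnorm (x - y) = hnorm (y - x)"
proof -
  have "Re (cinner (0 + scale (of_real (-1)) (y - x)) (0 + scale (of_real (-1)) (y - x)))
      = Re (cinner (y - x) (y - x))"
    using cinner_add_scale_self[of 0 "y - x" "-1"] assms carrier_closed cinner_zero by simp
  moreover have "scale (of_real (-1)) (y - x) = x - y"
    using scale_minus_left[of 1 "y - x"] by simp
  ultimately show ?thesis by (simp add: hnorm_def)
qed

sublocale Metric_space H hdist
proof
  fix x y z
  show "0 \<le> hdist x y" by (simp add: hdist_def hnorm_nonneg carrier_closed)
  show "hdist x y = hdist y x" by (simp add: hdist_def hnorm_minus_commute)
  assume x: "x \<in> H" and y: "y \<in> H"
  then show "hdist x y = 0 \<longleftrightarrow> x = y" by (simp add: hdist_def hnorm_eq_0 carrier_closed)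
  assume z: "z \<in> H"
  show "hdist x z \<le> hdist x y + hdist y z"
    using hnorm_add_le[of "x - y" "y - z"] x y z by (simp add: hdist_def carrier_closed)
qed

end

locale complex_hilbert_space = complex_inner_product_space +
  assumes complete: mcomplete

end

theory Submission
  imports Defs
begin

text \<open>On a weighted \<open>\<ell>\<^sup>2\<close> space over the integers the bilateral shift acts by
  \<open>e\<^sub>k \<mapsto> e\<^sub>k\<^sub>+\<^sub>1\<close>, so the orbit of \<open>e\<^sub>0\<close> reads off the square roots of the weights at
  \<open>0, 1, 2, \<dots>\<close>. The weight at \<open>k\<close> is \<open>1 / (1 + g)\<close>, where \<open>g\<close> is the distance of \<open>k\<close> from the
  union of the nonpositive numbers and the powers of two. Neighbouring weights differ at most by a
  factor 2, so the shift and its inverse are bounded. The weight is 1 at every power of two and tends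
  to 0 along \<open>3 * 2 ^ n\<close>, so multiples of \<open>e\<^sub>0\<close> form an uncountable scrambled set. Under the
  inverse each nonzero coordinate eventually moves to indices where the weight is 1, so
  no nonzero orbit comes close to 0.\<close>

section \<open>Linear Li-Yorke chaos and single orbits\<close>

context complex_inner_product_space
begin

lemma hnorm_scale:
  assumes "x \<in> H"
  shows "hnorm (scale a x) = cmod a * hnorm x"
proof -
  have ax: "scale a x \<in> H" using assms carrier_closed by blast
  have "cinner (scale a x) (scale a x) = a * cnj a * cinner x x"
    using assms ax cinner_commute[OF ax assms] cinner_commute[OF assms assms]
    by (simp add: cinner_scale_left)
  then have "Re (cinner (scale a x) (scale a x)) = (cmod a)\<^sup>2 * Re (cinner x x)"
    by (simp add: complex_norm_square[symmetric] del: of_real_power)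
  then show ?thesis by (simp add: hnorm_def real_sqrt_mult)
qed

lemma funpow_in_carrier:
  assumes "bounded_operator T" "x \<in> H"
  shows "(T ^^ n) x \<in> H"
  using assms by (induction n) (auto simp: bounded_operator_def)

lemma funpow_scale:
  assumes "bounded_operator T" "x \<in> H"
  shows "(T ^^ n) (scale a x) = scale a ((T ^^ n) x)"
proof (induction n)
  case (Suc n)
  then show ?case
    using assms funpow_in_carrier[OF assms, of n] by (simp add: bounded_operator_def)
qed simp

lemma funpow_diff:
  assumes T: "bounded_operator T" and "x \<in> H" "y \<in> H"
  shows "(T ^^ n) (x - y) = (T ^^ n) x - (T ^^ n) y"
proof -
  have add: "(T ^^ n) (u + v) = (T ^^ n) u + (T ^^ n) v" if "u \<in> H" "v \<in> H" for u v
  proof (induction n)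
    case (Suc n)
    then show ?case
      using T funpow_in_carrier[OF T that(1), of n] funpow_in_carrier[OF T that(2), of n]
      by (simp add: bounded_operator_def)
  qed simp
  show ?thesis
    using add[of "x - y" y] assms carrier_closed by (simp add: algebra_simps)
qed

lemma hdist_funpow:
  assumes "bounded_operator T" "x \<in> H" "y \<in> H"
  shows "hdist ((T ^^ n) x) ((T ^^ n) y) = hnorm ((T ^^ n) (x - y))"
  using assms by (simp add: hdist_def funpow_diff funpow_in_carrier)

text \<open>A vector with such an orbit is called semi-irregular; the line it spans is then a
  scrambled set.\<close>

lemma li_yorke_chaoticI:
  assumes T: "bounded_operator T" and x: "x \<in> H"
    and sup: "limsup (\<lambda>n. ereal (hnorm ((T ^^ n) x))) > 0"
    and inf: "liminf (\<lambda>n. ereal (hnorm ((T ^^ n) x))) = 0"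
  shows "li_yorke_chaotic T"
proof -
  \<comment> \<open>Needed for \<open>a \<mapsto> scale a x\<close> to be injective, which makes the
    line through \<open>x\<close> uncountable. The orbit of 0 is constantly 0 and would contradict
    \<open>sup\<close>.\<close>
  have "x \<noteq> 0"
  proof
    assume "x = 0"
    then have "(T ^^ n) x = 0" for n
      using funpow_scale[OF T x, of n 0] by simp
    then show False
      using sup hnorm_eq_0[OF carrier_closed(1)] by (simp add: Limsup_const)
  qed
  then have inj: "inj (\<lambda>a. scale a x)"
    by (auto intro: injI)
  have "uncountable (range (\<lambda>a. scale a x))"
    using inj uncountable_UNIV_complex countable_image_inj_eq by blast
  moreover have "li_yorke_pair T (scale a x) (scale c x)" if "scale a x \<noteq> scale c x" for a c
  proof -
    \<comment> \<open>By linearity, the distance between the orbits of two multiples of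
      \<open>x\<close> is this constant times the norm along the orbit of \<open>x\<close>, so both
      limits only get scaled.\<close>
    define r where "r = cmod (a - c)"
    have r: "r > 0" using that by (auto simp: r_def)
    have "hdist ((T ^^ n) (scale a x)) ((T ^^ n) (scale c x)) = r * hnorm ((T ^^ n) x)" for n
    proof -
      have "hdist ((T ^^ n) (scale a x)) ((T ^^ n) (scale c x)) = hnorm ((T ^^ n) (scale (a - c) x))"
        using hdist_funpow[OF T carrier_closed(3)[OF x] carrier_closed(3)[OF x]]
        by (simp add: scale_left_diff_distrib)
      then show ?thesis
        using T x by (simp add: funpow_scale hnorm_scale funpow_in_carrier r_def)
    qed
    then have "ereal (hdist ((T ^^ n) (scale a x)) ((T ^^ n) (scale c x)))
        = ereal r * ereal (hnorm ((T ^^ n) x))" for n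
      by simp
    then show ?thesis
      using r sup inf
      by (simp add: li_yorke_pair_def limsup_ereal_mult_left Liminf_ereal_mult_left
          ereal_zero_less_0_iff del: times_ereal.simps)
  qed
  ultimately show ?thesis
    unfolding li_yorke_chaotic_def
    using x carrier_closed(3) by (intro exI[of _ "range (\<lambda>a. scale a x)"]) auto
qed

text \<open>By linearity the distances along a pair are the norms along the orbit of the difference,
  a nonzero vector. A positive lower limit for every such orbit therefore rules out even a single
  Li-Yorke pair.\<close>

lemma not_li_yorke_chaoticI:
  assumes T: "bounded_operator T"
    and pos: "\<And>x. x \<in> H \<Longrightarrow> x \<noteq> 0 \<Longrightarrow> liminf (\<lambda>n. ereal (hnorm ((T ^^ n) x))) > 0"
  shows "\<not> li_yorke_chaotic T"
proof
  assume "li_yorke_chaotic T"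
  then obtain G where G: "G \<subseteq> H" "uncountable G"
    and pair: "\<And>x y. x \<in> G \<Longrightarrow> y \<in> G \<Longrightarrow> x \<noteq> y \<Longrightarrow> li_yorke_pair T x y"
    by (auto simp: li_yorke_chaotic_def)
  obtain x where x: "x \<in> G" using G(2) by fastforce
  have "uncountable (G - {x})" using G(2) by (simp add: uncountable_minus_countable)
  then have "G - {x} \<noteq> {}" by (metis countable_empty)
  then obtain y where y: "y \<in> G" "x \<noteq> y" by blast
  have "liminf (\<lambda>n. ereal (hnorm ((T ^^ n) (x - y)))) = 0"
    using pair[OF x y] x y G(1) T by (simp add: li_yorke_pair_def hdist_funpow subset_iff)
  then show False
    using pos[of "x - y"] x y G(1) carrier_closed(4) by (auto simp: subset_iff)
qed

end

section \<open>Weighted square-summable families\<close>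

locale weighted_l2 =
  fixes w :: "'i \<Rightarrow> real"
  assumes weight_pos: "w i > 0"
begin

lemma weight_nonneg [simp]: "0 \<le> w i"
  by (simp add: less_imp_le weight_pos)

definition carrier :: "('i \<Rightarrow> complex) set" where
  "carrier = {x. (\<lambda>i. w i * (cmod (x i))\<^sup>2) summable_on UNIV}"

definition inner_prod :: "('i \<Rightarrow> complex) \<Rightarrow> ('i \<Rightarrow> complex) \<Rightarrow> complex" where
  "inner_prod x y = (\<Sum>\<^sub>\<infinity>i. of_real (w i) * (x i * cnj (y i)))"

definition smul :: "complex \<Rightarrow> ('i \<Rightarrow> complex) \<Rightarrow> 'i \<Rightarrow> complex" where
  "smul c x = (\<lambda>i. c * x i)"

definition unit_vec :: "'i \<Rightarrow> 'i \<Rightarrow> complex" where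
  "unit_vec k = (\<lambda>i. if i = k then 1 else 0)"

lemma summable_prod:
  assumes "x \<in> carrier" "y \<in> carrier"
  shows "(\<lambda>i. of_real (w i) * (x i * cnj (y i))) summable_on UNIV"
proof (rule Infinite_Sum.abs_summable_summable, rule Infinite_Sum.abs_summable_on_comparison_test')
  show "(\<lambda>i. w i * (cmod (x i))\<^sup>2 + w i * (cmod (y i))\<^sup>2) summable_on UNIV"
    using assms by (auto simp: carrier_def intro: summable_on_add)
  fix i
  \<comment> \<open>The first fact bounds twice the product by the sum of squares; the second allows
    the factor 2 to be dropped.\<close>
  have "0 \<le> (cmod (x i) - cmod (y i))\<^sup>2" "0 \<le> cmod (x i) * cmod (y i)"
    by (rule zero_le_power2, rule mult_nonneg_nonneg) simp_all
  then have "cmod (x i) * cmod (y i) \<le> (cmod (x i))\<^sup>2 + (cmod (y i))\<^sup>2"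
    unfolding power2_diff by linarith
  then have "w i * (cmod (x i) * cmod (y i)) \<le> w i * ((cmod (x i))\<^sup>2 + (cmod (y i))\<^sup>2)"
    using weight_pos[of i] by (intro mult_left_mono) auto
  then show "norm (of_real (w i) * (x i * cnj (y i))) \<le> w i * (cmod (x i))\<^sup>2 + w i * (cmod (y i))\<^sup>2"
    using weight_pos[of i] by (simp add: norm_mult algebra_simps)
qed

lemma Re_inner_prod_self:
  assumes "x \<in> carrier"
  shows "Re (inner_prod x x) = (\<Sum>\<^sub>\<infinity>i. w i * (cmod (x i))\<^sup>2)"
proof -
  have eq: "Re (of_real (w i) * (x i * cnj (x i))) = w i * (cmod (x i))\<^sup>2" for i
    by (simp add: complex_norm_square[symmetric] del: of_real_power)
  then show ?thesis
    unfolding inner_prod_def infsum_Re[OF summable_prod[OF assms assms], symmetric] by (simp only: eq)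
qed

text \<open>The family is dominated termwise through
  \<open>|a + b|^2 \<le> 2 |a|^2 + 2 |b|^2\<close>, which follows from
  \<open>(|a| - |b|)^2 \<ge> 0\<close>.\<close>

lemma carrier_add:
  assumes "x \<in> carrier" "y \<in> carrier"
  shows "x + y \<in> carrier"
proof -
  have "(\<lambda>i. w i * (cmod ((x + y) i))\<^sup>2) summable_on UNIV"
  proof (rule summable_on_comparison_test)
    show "(\<lambda>i. 2 * (w i * (cmod (x i))\<^sup>2) + 2 * (w i * (cmod (y i))\<^sup>2)) summable_on UNIV"
      using assms by (auto simp: carrier_def intro!: summable_on_add summable_on_cmult_right)
    fix i
    have "(cmod (x i + y i))\<^sup>2 \<le> (cmod (x i) + cmod (y i))\<^sup>2"
      by (simp add: norm_triangle_ineq power_mono)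
    also have "\<dots> \<le> 2 * (cmod (x i))\<^sup>2 + 2 * (cmod (y i))\<^sup>2"
      using zero_le_power2[of "cmod (x i) - cmod (y i)"]
      by (simp add: power2_diff power2_sum)
    finally have "w i * (cmod (x i + y i))\<^sup>2 \<le> w i * (2 * (cmod (x i))\<^sup>2 + 2 * (cmod (y i))\<^sup>2)"
      using weight_pos[of i] by (intro mult_left_mono) auto
    then show "w i * (cmod ((x + y) i))\<^sup>2 \<le> 2 * (w i * (cmod (x i))\<^sup>2) + 2 * (w i * (cmod (y i))\<^sup>2)"
      by (simp add: algebra_simps)
  qed simp
  then show ?thesis by (simp add: carrier_def)
qed

lemma carrier_smul:
  assumes "x \<in> carrier"
  shows "smul c x \<in> carrier"
proof -
  have "(\<lambda>i. (cmod c)\<^sup>2 * (w i * (cmod (x i))\<^sup>2)) summable_on UNIV"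
    using assms by (auto simp: carrier_def intro: summable_on_cmult_right)
  then show ?thesis
    by (simp add: carrier_def smul_def norm_mult power_mult_distrib mult_ac)
qed

lemma inner_prod_pos:
  assumes "x \<in> carrier" "x \<noteq> 0"
  shows "Re (inner_prod x x) > 0"
proof -
  obtain k where k: "x k \<noteq> 0" using assms(2) by (auto simp: fun_eq_iff)
  have "0 < w k * (cmod (x k))\<^sup>2" using k weight_pos by simp
  also have "\<dots> \<le> (\<Sum>\<^sub>\<infinity>i. w i * (cmod (x i))\<^sup>2)"
    using finite_sum_le_infsum[of "\<lambda>i. w i * (cmod (x i))\<^sup>2" UNIV "{k}"] assms(1)
    by (auto simp: carrier_def)
  finally show ?thesis by (simp add: Re_inner_prod_self assms(1))
qed

sublocale complex_inner_product_space smul carrier inner_prod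
proof -
  interpret vector_space smul
    by unfold_locales (auto simp: smul_def fun_eq_iff algebra_simps)
  have add: "inner_prod (x + y) z = inner_prod x z + inner_prod y z"
    if "x \<in> carrier" "y \<in> carrier" "z \<in> carrier" for x y z
    using infsum_add[OF summable_prod[OF that(1,3)] summable_prod[OF that(2,3)]]
    by (simp add: inner_prod_def algebra_simps)
  \<comment> \<open>Homogeneity and conjugate symmetry hold for all families, since the default
    value 0 of a divergent sum respects both. Additivity is where convergence enters.\<close>
  have scale: "inner_prod (smul a x) y = a * inner_prod x y" for a x y
    using infsum_cmult_right'[of a "\<lambda>i. of_real (w i) * (x i * cnj (y i))" UNIV]
    by (simp add: inner_prod_def smul_def mult_ac)
  have cnj: "inner_prod y x = cnj (inner_prod x y)" for x y
    unfolding inner_prod_def infsum_cnj[symmetric] by (simp add: mult_ac)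
  have sub: "subspace carrier"
    by (rule subspaceI) (auto simp: carrier_add carrier_smul, simp add: carrier_def)
  show "complex_inner_product_space smul carrier inner_prod"
    by unfold_locales (rule sub | (rule add scale cnj inner_prod_pos; assumption))+
qed

lemma hnorm_sq_infsum: "x \<in> carrier \<Longrightarrow> (hnorm x)\<^sup>2 = (\<Sum>\<^sub>\<infinity>i. w i * (cmod (x i))\<^sup>2)"
  by (simp add: hnorm_square Re_inner_prod_self)

section \<open>Estimates by finite sums, and completeness\<close>

lemma sum_le_hnorm_sq:
  assumes "x \<in> carrier" "finite F"
  shows "(\<Sum>i\<in>F. w i * (cmod (x i))\<^sup>2) \<le> (hnorm x)\<^sup>2"
  using finite_sum_le_infsum[of "\<lambda>i. w i * (cmod (x i))\<^sup>2" UNIV F] assms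
  by (auto simp: carrier_def hnorm_sq_infsum)

lemma weight_le_hnorm_sq: "x \<in> carrier \<Longrightarrow> w k * (cmod (x k))\<^sup>2 \<le> (hnorm x)\<^sup>2"
  using sum_le_hnorm_sq[of x "{k}"] by simp

text \<open>All terms are nonnegative, so a uniform bound on finite sums gives convergence and
  bounds the limit. Both coordinatewise limits and reindexed families enter \<open>carrier\<close>
  this way.\<close>

lemma hnorm_le_of_sums:
  assumes "\<And>F. finite F \<Longrightarrow> (\<Sum>i\<in>F. w i * (cmod (x i))\<^sup>2) \<le> C\<^sup>2" and C: "0 \<le> C"
  shows "x \<in> carrier" "hnorm x \<le> C"
proof -
  have "(\<lambda>i. w i * (cmod (x i))\<^sup>2) summable_on UNIV"
    by (rule nonneg_bdd_above_summable_on)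
      (use assms(1) in \<open>auto intro!: bdd_aboveI[of _ "C\<^sup>2"]\<close>)
  then show x: "x \<in> carrier" by (simp add: carrier_def)
  have "(hnorm x)\<^sup>2 \<le> C\<^sup>2"
    unfolding hnorm_sq_infsum[OF x]
    by (rule infsum_le_finite_sums) (use x assms in \<open>auto simp: carrier_def\<close>)
  then show "hnorm x \<le> C" using C by (rule power2_le_imp_le)
qed

text \<open>Cauchy sequences converge in each coordinate. Estimates on finitely many coordinates
  survive this limit, and together they control the whole norm.\<close>

lemma carrier_mcomplete: mcomplete
  unfolding mcomplete_def
proof (intro allI impI)
  fix s :: "nat \<Rightarrow> 'i \<Rightarrow> complex"
  assume "MCauchy s"
  then have s: "s n \<in> carrier" for n by (auto simp: MCauchy_def)
  have s_diff: "s m - s n \<in> carrier" for m n by (rule carrier_closed(4)[OF s s])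
  have cau: "\<exists>N. \<forall>m\<ge>N. \<forall>n\<ge>N. hnorm (s m - s n) < e" if "e > 0" for e
    using \<open>MCauchy s\<close> that s by (auto simp: MCauchy_def hdist_def)
  have "Cauchy (\<lambda>n. s n i)" for i
  proof (rule metric_CauchyI)
    fix e :: real assume "e > 0"
    \<comment> \<open>The norm dominates coordinate \<open>i\<close> only after scaling by
      \<open>sqrt (w i)\<close>, so the tolerance is scaled likewise.\<close>
    then obtain N where N: "\<And>m n. m \<ge> N \<Longrightarrow> n \<ge> N \<Longrightarrow> hnorm (s m - s n) < e * sqrt (w i)"
      using cau[of "e * sqrt (w i)"] weight_pos[of i] by auto
    have "dist (s m i) (s n i) < e" if "m \<ge> N" "n \<ge> N" for m n
    proof -
      have "w i * (cmod (s m i - s n i))\<^sup>2 \<le> (hnorm (s m - s n))\<^sup>2"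
        using weight_le_hnorm_sq[OF s_diff[of m n], of i] by simp
      then have "sqrt (w i) * cmod (s m i - s n i) \<le> hnorm (s m - s n)"
        using real_sqrt_le_mono hnorm_nonneg[OF s_diff[of m n]] by (fastforce simp: real_sqrt_mult)
      also have "\<dots> < sqrt (w i) * e" using N[OF that] by (simp add: mult.commute)
      finally show ?thesis using weight_pos[of i] by (simp add: dist_norm)
    qed
    then show "\<exists>M. \<forall>m\<ge>M. \<forall>n\<ge>M. dist (s m i) (s n i) < e" by blast
  qed
  then have "\<forall>i. \<exists>l. (\<lambda>n. s n i) \<longlonglongrightarrow> l"
    by (simp add: Cauchy_convergent_iff convergent_def)
  then obtain l where l: "\<And>i. (\<lambda>n. s n i) \<longlonglongrightarrow> l i" by metis
  \<comment> \<open>Let \<open>n\<close> tend to infinity in the finite sums for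
    \<open>s m - s n\<close>. The strict bound becomes a weak one, which is why \<open>e / 2\<close>
    is used below.\<close>
  have close: "s m - l \<in> carrier \<and> hnorm (s m - l) \<le> e"
    if e: "e > 0" and N: "\<And>m n. m \<ge> N \<Longrightarrow> n \<ge> N \<Longrightarrow> hnorm (s m - s n) < e" and m: "m \<ge> N"
    for e N m
  proof -
    have "(\<Sum>i\<in>F. w i * (cmod ((s m - l) i))\<^sup>2) \<le> e\<^sup>2" if F: "finite F" for F
    proof (rule tendsto_upperbound)
      show "(\<lambda>n. \<Sum>i\<in>F. w i * (cmod (s m i - s n i))\<^sup>2)
          \<longlonglongrightarrow> (\<Sum>i\<in>F. w i * (cmod ((s m - l) i))\<^sup>2)"
        by (auto intro!: tendsto_intros l)
      have "(\<Sum>i\<in>F. w i * (cmod (s m i - s n i))\<^sup>2) \<le> e\<^sup>2" if "n \<ge> N" for n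
      proof -
        have "(\<Sum>i\<in>F. w i * (cmod (s m i - s n i))\<^sup>2) \<le> (hnorm (s m - s n))\<^sup>2"
          using sum_le_hnorm_sq[OF s_diff[of m n] F] by simp
        also have "\<dots> \<le> e\<^sup>2"
          using N[OF m that] hnorm_nonneg[OF s_diff[of m n]] by (simp add: power_mono)
        finally show ?thesis .
      qed
      then show "\<forall>\<^sub>F n in sequentially. (\<Sum>i\<in>F. w i * (cmod (s m i - s n i))\<^sup>2) \<le> e\<^sup>2"
        using eventually_sequentially by blast
    qed simp
    then show ?thesis using hnorm_le_of_sums[of "s m - l" e] e by auto
  qed
  obtain N where "\<And>m n. m \<ge> N \<Longrightarrow> n \<ge> N \<Longrightarrow> hnorm (s m - s n) < 1"
    using cau[of 1] by auto
  from close[OF _ this, of N] have "s N - l \<in> carrier" by simp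
  \<comment> \<open>Here \<open>l\<close> is written as \<open>s N - (s N - l)\<close>.\<close>
  from carrier_closed(4)[OF s[of N] this] have lc: "l \<in> carrier" by simp
  have "\<exists>N. \<forall>n\<ge>N. hdist (s n) l < e" if "e > 0" for e
  proof -
    from cau[OF half_gt_zero[OF that]]
    obtain N where "\<And>m n. m \<ge> N \<Longrightarrow> n \<ge> N \<Longrightarrow> hnorm (s m - s n) < e / 2"
      by blast
    from close[OF _ this] have "hnorm (s n - l) \<le> e / 2" if "n \<ge> N" for n
      using that \<open>e > 0\<close> by simp
    then show ?thesis using that s lc by (fastforce simp: hdist_def)
  qed
  then show "\<exists>x. limitin mtopology s x sequentially"
    using s lc by (auto simp: limit_metric_sequentially intro!: exI[of _ l])
qed

sublocale complex_hilbert_space smul carrier inner_prod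
  by unfold_locales (rule carrier_mcomplete)

section \<open>Unit vectors and the dimension\<close>

lemma unit_vec_carrier: "unit_vec k \<in> carrier"
  and hnorm_unit_vec: "hnorm (unit_vec k) = sqrt (w k)"
proof -
  have eq: "w i * (cmod (unit_vec k i))\<^sup>2 = (if i = k then w k else 0)" for i
    by (simp add: unit_vec_def)
  have "((\<lambda>i. if i = k then w k else 0) has_sum w k) UNIV"
    by (rule has_sum_finite_neutralI[of "{k}"]) auto
  then have *: "((\<lambda>i. w i * (cmod (unit_vec k i))\<^sup>2) has_sum w k) UNIV"
    by (simp add: eq)
  then show u: "unit_vec k \<in> carrier"
    by (auto simp: carrier_def summable_on_def)
  show "hnorm (unit_vec k) = sqrt (w k)"
    using infsumI[OF *] hnorm_sq_infsum[OF u] hnorm_nonneg[OF u]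
    by (metis real_sqrt_abs abs_of_nonneg)
qed

text \<open>The unit vectors form an infinite independent set, while a finite spanning set would
  bound the size of every independent set.\<close>

lemma infinite_dimensional:
  assumes "infinite (UNIV :: 'i set)"
  shows infinite_dimensional
  unfolding infinite_dimensional_def
proof
  assume "\<exists>B. finite B \<and> span B = carrier"
  then obtain B where B: "finite B" "span B = carrier" by blast
  have inj: "inj unit_vec"
    by (rule injI) (metis unit_vec_def zero_neq_one)
  have "independent (range unit_vec)"
  proof
    assume "dependent (range unit_vec)"
    then obtain t u v where t: "finite t" "t \<subseteq> range unit_vec" "(\<Sum>v\<in>t. smul (u v) v) = 0"
      and v: "v \<in> t" "u v \<noteq> 0"
      unfolding dependent_explicit by blast
    obtain j where j: "v = unit_vec j" using t(2) v(1) by blast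
    \<comment> \<open>Evaluating the relation at coordinate \<open>j\<close> isolates the
      coefficient of \<open>unit_vec j\<close>, as the other unit vectors vanish there.\<close>
    have "(\<Sum>v\<in>t. smul (u v) v) j = (\<Sum>v\<in>t. smul (u v) v j)"
      using t(1) by (induction t rule: finite_induct) auto
    also have "\<dots> = (\<Sum>v\<in>{unit_vec j}. smul (u v) v j)"
    proof (intro sum.mono_neutral_right ballI)
      fix x assume "x \<in> t - {unit_vec j}"
      then obtain i where "x = unit_vec i" "i \<noteq> j" using t(2) by blast
      then show "smul (u x) x j = 0" by (simp add: smul_def unit_vec_def)
    qed (use t(1) v(1) j in auto)
    also have "\<dots> = u v" by (simp add: j smul_def unit_vec_def)
    finally show False using t(3) v(2) by simp
  qed
  then have "finite (range unit_vec)"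
    using independent_span_bound[OF B(1), of "range unit_vec"] B(2) unit_vec_carrier by auto
  then show False using assms inj finite_imageD by blast
qed

text \<open>Trading \<open>w i\<close> for \<open>K * w (p i)\<close> and reindexing along the
  injective \<open>p\<close> turns each finite sum for \<open>x \<circ> p\<close> into
  \<open>K\<close> times one for \<open>x\<close>; the norm bound is \<open>sqrt K\<close>.\<close>

lemma composition_operator:
  assumes bij: "bij p" and K: "\<And>i. w i \<le> K * w (p i)"
  shows "bounded_operator (\<lambda>x. x \<circ> p)"
proof -
  have "0 < K * w (p i)" for i using weight_pos[of i] K[of i] by simp
  then have "K \<ge> 0" using weight_pos by (metis less_imp_le zero_less_mult_pos2)
  have *: "x \<circ> p \<in> carrier \<and> hnorm (x \<circ> p) \<le> sqrt K * hnorm x" if x: "x \<in> carrier" for x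
  proof -
    have "(\<Sum>i\<in>F. w i * (cmod ((x \<circ> p) i))\<^sup>2) \<le> (sqrt K * hnorm x)\<^sup>2" if "finite F" for F
    proof -
      have "(\<Sum>i\<in>F. w i * (cmod ((x \<circ> p) i))\<^sup>2) \<le> (\<Sum>i\<in>F. K * (w (p i) * (cmod (x (p i)))\<^sup>2))"
        using K by (intro sum_mono) (auto simp: mult.assoc[symmetric] intro: mult_right_mono)
      also have "\<dots> = K * (\<Sum>i\<in>p ` F. w i * (cmod (x i))\<^sup>2)"
        using inj_on_subset[OF bij_is_inj[OF bij]]
        by (simp add: sum_distrib_left sum.reindex)
      also have "\<dots> \<le> K * (hnorm x)\<^sup>2"
        using \<open>K \<ge> 0\<close> x that by (intro mult_left_mono sum_le_hnorm_sq) auto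
      finally show ?thesis using \<open>K \<ge> 0\<close> by (simp add: power_mult_distrib)
    qed
    then show ?thesis
      using hnorm_le_of_sums[of "x \<circ> p" "sqrt K * hnorm x"] \<open>K \<ge> 0\<close> hnorm_nonneg[OF x] by auto
  qed
  then show ?thesis
    unfolding bounded_operator_def by (auto simp: smul_def fun_eq_iff)
qed

end

section \<open>The bilateral shift\<close>

text \<open>The integers are identified with the naturals, since the ambient space of the theorem
  consists of sequences indexed by \<open>nat\<close>.\<close>

definition int_shift :: "int \<Rightarrow> nat \<Rightarrow> nat" where
  "int_shift t n = int_encode (int_decode n + t)"

lemma int_shift_simps [simp]:
  "int_shift s (int_shift t n) = int_shift (s + t) n" "int_shift 0 n = n"
  by (simp_all add: int_shift_def algebra_simps)

lemma bij_int_shift: "bij (int_shift t)"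
  by (rule o_bij[of "int_shift (- t)"]) (auto simp: fun_eq_iff)

lemma funpow_comp_int_shift:
  "((\<lambda>x. x \<circ> int_shift t) ^^ n) x = x \<circ> int_shift (int n * t)"
  by (induction n) (auto simp: fun_eq_iff algebra_simps)

section \<open>The weights, built from the distance to a set of peaks\<close>

definition peaks :: "real set" where
  "peaks = {..0} \<union> range (\<lambda>n. 2 ^ n)"

definition gap :: "int \<Rightarrow> real" where
  "gap k = infdist (real_of_int k) peaks"

lemma gap_nonneg: "0 \<le> gap k"
  by (simp add: gap_def infdist_nonneg)

text \<open>The distance to a fixed set is 1-Lipschitz.\<close>

lemma gap_neighbour: "gap (k + 1) \<le> gap k + 1" "gap k \<le> gap (k + 1) + 1"
  using infdist_triangle_abs[of "real_of_int (k + 1)" peaks "real_of_int k"]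
  by (auto simp: gap_def dist_real_def)

lemma gap_nonpos: "k \<le> 0 \<Longrightarrow> gap k = 0"
  by (simp add: gap_def peaks_def)

lemma gap_power2: "gap (2 ^ n) = 0"
  by (simp add: gap_def peaks_def)

text \<open>The point is the midpoint of the consecutive peaks \<open>2 ^ (n + 1)\<close> and
  \<open>2 ^ (n + 2)\<close>, at distance \<open>2 ^ n\<close> from each.\<close>

lemma gap_between: "2 ^ n \<le> gap (3 * 2 ^ n)"
proof -
  have "2 ^ n \<le> dist (3 * 2 ^ n) a" if a: "a \<in> peaks" for a :: real
  proof (cases "a \<le> 0")
    case False
    then obtain m where m: "a = 2 ^ m" using a by (auto simp: peaks_def)
    show ?thesis
    proof (cases "m \<le> n + 1")
      case True
      then have "(2::real) ^ m \<le> 2 ^ (n + 1)" by (intro power_increasing) auto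
      then show ?thesis by (simp add: m dist_real_def)
    next
      case False
      then have "(2::real) ^ (n + 2) \<le> 2 ^ m" by (intro power_increasing) auto
      then show ?thesis by (simp add: m dist_real_def)
    qed
  qed (simp add: dist_real_def)
  moreover have "peaks \<noteq> {}" by (auto simp: peaks_def)
  ultimately show ?thesis
    by (simp add: gap_def infdist_notempty cINF_greatest)
qed

definition weight :: "nat \<Rightarrow> real" where
  "weight n = 1 / (1 + gap (int_decode n))"

text \<open>If neighbouring gaps are \<open>g\<close> and \<open>h\<close>, then
  \<open>1 + h \<le> 2 + g \<le> 2 * (1 + g)\<close>.\<close>

lemma weight_shift:
  "weight n \<le> 2 * weight (int_shift 1 n)" "weight n \<le> 2 * weight (int_shift (-1) n)"
  using gap_neighbour(1)[of "int_decode n"] gap_neighbour(2)[of "int_decode n - 1"]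
    gap_nonneg[of "int_decode n"] gap_nonneg[of "int_decode n + 1"] gap_nonneg[of "int_decode n - 1"]
  by (auto simp: weight_def int_shift_def field_simps)

section \<open>The shift operators and their orbits\<close>

interpretation shift: weighted_l2 weight
  by unfold_locales (use gap_nonneg in \<open>simp add: weight_def add_pos_nonneg\<close>)

text \<open>Composition with \<open>int_shift (-1)\<close> moves the unit vector at \<open>k\<close>
  to \<open>k + 1\<close>, so the negative sign belongs to the forward shift.\<close>

lemma shift_bounded:
  "shift.bounded_operator (\<lambda>x. x \<circ> int_shift (-1))" "shift.bounded_operator (\<lambda>x. x \<circ> int_shift 1)"
  by (rule shift.composition_operator[OF bij_int_shift weight_shift(2)],
      rule shift.composition_operator[OF bij_int_shift weight_shift(1)])

lemma shift_orbit_norm: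
  "shift.hnorm (((\<lambda>x. x \<circ> int_shift (-1)) ^^ n) (shift.unit_vec (int_encode 0)))
    = sqrt (1 / (1 + gap (int n)))"
proof -
  have "shift.unit_vec (int_encode 0) \<circ> int_shift (- int n) = shift.unit_vec (int_encode (int n))"
    by (auto simp: fun_eq_iff shift.unit_vec_def int_shift_def int_encode_eq)
       (metis int_decode_inverse)
  then show ?thesis
    by (simp add: funpow_comp_int_shift shift.hnorm_unit_vec weight_def)
qed

lemma shift_chaotic: "shift.li_yorke_chaotic (\<lambda>x. x \<circ> int_shift (-1))"
proof (rule shift.li_yorke_chaoticI[OF shift_bounded(1) shift.unit_vec_carrier])
  define f where "f n = ereal (sqrt (1 / (1 + gap (int n))))" for n
  have nonneg: "0 \<le> f n" for n by (simp add: f_def gap_nonneg)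
  \<comment> \<open>At the times \<open>2 ^ m\<close> the orbit sits on a peak, which keeps the
    upper limit at least 1.\<close>
  have "f \<circ> (\<lambda>m. 2 ^ m) = (\<lambda>_. 1)"
    by (simp add: fun_eq_iff f_def gap_power2 one_ereal_def)
  then have "1 \<le> limsup f"
    using limsup_subseq_mono[of "\<lambda>m. 2 ^ m" f] by (simp add: strict_mono_def Limsup_const)
  then show "0 < limsup (\<lambda>n. ereal (shift.hnorm
      (((\<lambda>x. x \<circ> int_shift (-1)) ^^ n) (shift.unit_vec (int_encode 0)))))"
    unfolding shift_orbit_norm f_def[symmetric]  by (rule less_le_trans[rotated]) simp
  \<comment> \<open>At the times \<open>3 * 2 ^ m\<close> the orbit is midway between peaks, and
    this subsequence forces the lower limit down to 0.\<close>
  have "(\<lambda>m. sqrt (1 / (1 + gap (3 * 2 ^ m)))) \<longlonglongrightarrow> 0"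
  proof (rule real_tendsto_sandwich[where f = "\<lambda>_. 0" and h = "\<lambda>m. sqrt ((1 / 2) ^ m)"])
    show "\<forall>\<^sub>F m in sequentially. sqrt (1 / (1 + gap (3 * 2 ^ m))) \<le> sqrt ((1 / 2) ^ m)"
    proof (intro always_eventually allI, rule real_sqrt_le_mono)
      fix m
      have "(2::real) ^ m \<le> 1 + gap (3 * 2 ^ m)" using gap_between[of m] by simp
      then show "1 / (1 + gap (3 * 2 ^ m)) \<le> (1 / 2) ^ m"
        using frac_le[of 1 1 "2 ^ m" "1 + gap (3 * 2 ^ m)"] by (simp add: power_one_over)
    qed
    have "(\<lambda>m. (1 / 2 :: real) ^ m) \<longlonglongrightarrow> 0" by (rule LIMSEQ_power_zero) simp
    from tendsto_real_sqrt[OF this] show "(\<lambda>m. sqrt ((1 / 2) ^ m)) \<longlonglongrightarrow> 0"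
      by (simp only: real_sqrt_zero)
  qed (auto simp: gap_nonneg)
  then have "(f \<circ> (\<lambda>m. 3 * 2 ^ m)) \<longlonglongrightarrow> 0"
    by (simp add: f_def o_def zero_ereal_def)
  then have "liminf (f \<circ> (\<lambda>m. 3 * 2 ^ m)) = 0"
    by (intro lim_imp_Liminf) auto
  then have "liminf f \<le> 0"
    using liminf_subseq_mono[of "\<lambda>m. 3 * 2 ^ m" f] by (simp add: strict_mono_def)
  moreover have "0 \<le> liminf f" by (rule Liminf_bounded) (simp add: nonneg)
  ultimately show "liminf (\<lambda>n. ereal (shift.hnorm
      (((\<lambda>x. x \<circ> int_shift (-1)) ^^ n) (shift.unit_vec (int_encode 0))))) = 0"
    unfolding shift_orbit_norm f_def[symmetric] by simp
qed

text \<open>After \<open>n\<close> backward steps the entry \<open>x k\<close> stands at the integer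
  \<open>int_decode k - n\<close>, which is nonpositive and so has weight 1. This single coordinate
  bounds the norm from below.\<close>

lemma backward_orbit_norm:
  assumes x: "x \<in> shift.carrier" and n: "int_decode k \<le> int n"
  shows "cmod (x k) \<le> shift.hnorm (((\<lambda>x. x \<circ> int_shift 1) ^^ n) x)"
proof -
  have c: "x \<circ> int_shift (int n) \<in> shift.carrier"
    using shift.funpow_in_carrier[OF shift_bounded(2) x, of n] by (simp add: funpow_comp_int_shift)
  have "weight (int_shift (- int n) k) = 1"
    using n by (simp add: weight_def int_shift_def gap_nonpos)
  then have "(cmod (x k))\<^sup>2 \<le> (shift.hnorm (x \<circ> int_shift (int n)))\<^sup>2"
    using shift.weight_le_hnorm_sq[OF c, of "int_shift (- int n) k"] by simp
  from power2_le_imp_le[OF this shift.hnorm_nonneg[OF c]]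
  show ?thesis by (simp add: funpow_comp_int_shift)
qed

text \<open>Stated for any \<open>S\<close> that agrees with the backward shift on
  \<open>carrier\<close>, because \<open>inv_into\<close> is determined only there.\<close>

lemma backward_not_chaotic:
  assumes "shift.bounded_operator S" and S: "\<And>x. x \<in> shift.carrier \<Longrightarrow> S x = x \<circ> int_shift 1"
  shows "\<not> shift.li_yorke_chaotic S"
proof (rule shift.not_li_yorke_chaoticI[OF assms(1)])
  fix x assume x: "x \<in> shift.carrier" "x \<noteq> 0"
  then obtain k where k: "x k \<noteq> 0" by (auto simp: fun_eq_iff)
  have pow: "(S ^^ n) x = ((\<lambda>x. x \<circ> int_shift 1) ^^ n) x" for n
  proof (induction n)
    case (Suc n)
    then show ?case using S[OF shift.funpow_in_carrier[OF assms(1) x(1), of n]] by simp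
  qed simp
  have "ereal (cmod (x k)) \<le> liminf (\<lambda>n. ereal (shift.hnorm ((S ^^ n) x)))"
  proof (rule Liminf_bounded)
    \<comment> \<open>From this time on coordinate \<open>k\<close> has reached the nonpositive
      indices; if \<open>int_decode k\<close> is negative, \<open>nat\<close> gives the threshold
      0.\<close>
    have "ereal (cmod (x k)) \<le> ereal (shift.hnorm ((S ^^ n) x))" if "n \<ge> nat (int_decode k)" for n
      using backward_orbit_norm[OF x(1), of k n] that by (simp add: pow)
    then show "\<forall>\<^sub>F n in sequentially. ereal (cmod (x k)) \<le> ereal (shift.hnorm ((S ^^ n) x))"
      using eventually_sequentially by blast
  qed
  moreover have "0 < ereal (cmod (x k))" using k by simp
  ultimately show "0 < liminf (\<lambda>n. ereal (shift.hnorm ((S ^^ n) x)))" by (rule less_le_trans[rotated])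
qed

theorem theorem2p1:
  shows "\<exists>(scale :: complex \<Rightarrow> (nat \<Rightarrow> complex) \<Rightarrow> (nat \<Rightarrow> complex)) H cinner T.
    complex_hilbert_space scale H cinner \<and>
    complex_inner_product_space.infinite_dimensional scale H \<and>
    complex_inner_product_space.invertible_operator scale H cinner T \<and>
    Metric_space.li_yorke_chaotic H
      (complex_inner_product_space.hdist H cinner) T \<and>
    \<not> Metric_space.li_yorke_chaotic H
      (complex_inner_product_space.hdist H cinner) (inv_into H T)"
proof (intro exI conjI)
  let ?T = "\<lambda>x :: nat \<Rightarrow> complex. x \<circ> int_shift (-1)" and ?S = "\<lambda>x :: nat \<Rightarrow> complex. x \<circ> int_shift 1"
  have T: "?T x \<in> shift.carrier" and S: "?S x \<in> shift.carrier" if "x \<in> shift.carrier" for x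
    using shift_bounded that by (auto simp: shift.bounded_operator_def)
  have TS: "?T (?S x) = x" and ST: "?S (?T x) = x" for x
    by (auto simp: fun_eq_iff)
  have bij: "bij_betw ?T shift.carrier shift.carrier"
    using T S TS ST by (intro bij_betw_byWitness[of _ ?S]) auto
  have inv: "inv_into shift.carrier ?T x = ?S x" if "x \<in> shift.carrier" for x
    using inv_into_f_f[OF bij_betw_imp_inj_on[OF bij] S[OF that]] by (simp only: TS)
  have inv_bounded: "shift.bounded_operator (inv_into shift.carrier ?T)"
    using shift_bounded(2) inv S shift.carrier_closed
    unfolding shift.bounded_operator_def by (auto simp: Pi_iff)
  \<comment> \<open>This goal fixes the witnesses for the space; the goal on invertibility fixes
    \<open>?T\<close> as the operator.\<close>
  show "complex_hilbert_space shift.smul shift.carrier shift.inner_prod"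
    by (rule shift.complex_hilbert_space_axioms)
  show shift.infinite_dimensional
    by (rule shift.infinite_dimensional) simp
  show "shift.invertible_operator ?T"
    using shift_bounded(1) bij inv_bounded by (simp add: shift.invertible_operator_def)
  show "shift.li_yorke_chaotic ?T" by (rule shift_chaotic)
  show "\<not> shift.li_yorke_chaotic (inv_into shift.carrier ?T)"
    using backward_not_chaotic[OF inv_bounded inv] .
qed

end
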